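(* Let $\Sigma=(\widetilde{\mathbf{x}},\Lambda,\widetilde{B})$ be an acyclic quantum seed with principal coefficients, with indices ordered so that $b_{ij}\ge 0$ for all $n\ge i>j\ge 1$. For any $j\in[2,n]$ and $l\in\mathbb{N}$ set $$f_{j-1,l}^{(j)}:=(x_j^{(n)})^l x_{j-1}-q^{-l\lambda_{j,j-1}}x_{j-1}(x_j^{(n)})^l .$$ Then $f_{j-1,1}^{(j)}\in\mathbb{ZP}[x_1^{(n)},\dots,x_{j-1}^{(n)},x_j,\dots,x_n]$, and $f_{j-1,l}^{(j)}\in\mathbb{ZP}[x_1^{(n)},\dots,x_{j-1}^{(n)},x_j^{(n)},x_j,\dots,x_n]$ for any $l\ge2$.
   Context: Notation: $[s,t]=\{s,s+1,\dots,t\}$; $[x]_+=\max(x,0)$, applied entrywise to vectors; $\mathbf{e}_i$ is the $i$-th unit vector. Quantum seeds. Let $\widetilde{B}=(b_{ij})$ be a $2n\times n$ integer matrix with columns $\mathbf{b}_1,\dots,\mathbf{b}_n$, whose upper $n\times n$ part $B$ is skew-symmetrizable: $DB$ is skew-symmetric for $D=\mathrm{diag}(d_1,\dots,d_n)$ with positive integer $d_j$. "Principal coefficients" means that the lower $n\times n$ part of $\widetilde{B}$ is the identity, i.e. $b_{n+i,j}=\delta_{ij}$. Let $\Lambda=(\lambda_{ij})$ be a skew-symmetric $2n\times 2n$ integer matrix, identified with the bilinear form on $\mathbb{Z}^{2n}$ with $\Lambda(\mathbf{e}_i,\mathbf{e}_j)=\lambda_{ij}$, compatible with $\widetilde{B}$: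 $\Lambda(\mathbf{b}_j,\mathbf{e}_i)=\delta_{ij}d_j$ for $i\in[1,2n]$, $j\in[1,n]$. The quantum torus $\mathcal{T}$ is the $\mathbb{Z}[q^{\pm 1/2}]$-algebra with basis $\{X^{\mathbf{a}}:\mathbf{a}\in\mathbb{Z}^{2n}\}$ and product $X^{\mathbf{a}}X^{\mathbf{c}}=q^{\Lambda(\mathbf{a},\mathbf{c})/2}X^{\mathbf{a}+\mathbf{c}}$; $\mathcal{F}$ is its skew-field of fractions and $x_i=X^{\mathbf{e}_i}$, so $x_ix_j=q^{\lambda_{ij}}x_jx_i$ and $X^{\mathbf{a}}=q^{\frac12\sum_{l<k}a_ka_l\lambda_{kl}}x_1^{a_1}\cdots x_{2n}^{a_{2n}}$. The triple $\Sigma=(\widetilde{\mathbf{x}},\Lambda,\widetilde{B})$ with $\widetilde{\mathbf{x}}=\{x_1,\dots,x_{2n}\}$ is a quantum seed. $\mathbb{ZP}=\mathbb{Z}[q^{\pm1/2}][x_{n+1}^{\pm1},\dots,x_{2n}^{\pm1}]$, a (quasi-commutative) subring of $\mathcal{F}$; $\mathbb{ZP}[y_1,y_2,\dots]$ denotes the subring of $\mathcal{F}$ generated by $\mathbb{ZP}$ and the $y_i$. Mutation. For $k\in[1,n]$, the mutation $\mu_k$ replaces $x_k$ by $x_k'=X^{-\mathbf{e}_k+[\mathbf{b}_k]_+}+X^{-\mathbf{e}_k+[-\mathbf{b}_k]_+}$, replaces $\widetilde{B}$ by $\widetilde{B}'$ with $b'_{ij}=-b_{ij}$ if $i=k$ or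 $j=k$, and $b'_{ij}=b_{ij}+\frac{|b_{ik}|b_{kj}+b_{ik}|b_{kj}|}{2}$ otherwise, and replaces $\Lambda$ by the skew-symmetric $\Lambda'$ with $\lambda'_{ij}=\lambda_{ij}$ for $i,j\ne k$ and $\lambda'_{kj}=-\lambda_{kj}+\sum_{t}[b_{tk}]_+\lambda_{tj}$ for $j\neq k$. The same rule applies to any seed obtained by mutation, with $X^{\mathbf{a}}$ formed from the variables and form of that seed by the normalized ordered monomial formula above. A seed is acyclic if the directed graph on $[1,n]$ with an edge $i\to j$ whenever $b_{ij}>0$ has no oriented cycle; in this case, after reordering, one assumes $b_{ij}\ge0$ for all $i>j$ in $[1,n]$. Projective cluster variables. For $i\in[1,n]$ put $\Sigma^{(i)}=(\widetilde{\mathbf{x}}^{(i)},\Lambda^{(i)},\widetilde{B}^{(i)})=\mu_i\cdots\mu_2\mu_1(\Sigma)$ ($\mu_1$ is applied first), with $\widetilde{\mathbf{x}}^{(i)}=\{x_1^{(i)},\dots,x_{2n}^{(i)}\}$. The elements $x_1^{(n)},\dots,x_n^{(n)}$ of the cluster of $\Sigma^{(n)}$ are the quantum projective cluster variables. *)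

theory Defs
  imports Complex_Main
begin

text \<open>
  Vectors in \<open>\<int>\<^sup>m\<close> are functions \<open>nat \<Rightarrow> int\<close> on the index set \<open>{1..m}\<close>, vanishing elsewhere;
  matrices are functions \<open>nat \<Rightarrow> nat \<Rightarrow> int\<close> of which only the entries with indices in range matter.
  The variable \<open>h\<close> always stands for \<open>q\<^sup>1\<^sup>/\<^sup>2\<close>, so that \<open>q = h\<^sup>2\<close>.
\<close>

definition lattice_vecs :: "nat \<Rightarrow> (nat \<Rightarrow> int) set" where
  "lattice_vecs m = {a. \<forall>i. i \<notin> {1..m} \<longrightarrow> a i = 0}"

definition unit_vec :: "nat \<Rightarrow> nat \<Rightarrow> int" where
  "unit_vec k = (\<lambda>i. if i = k then 1 else 0)"

definition bilin :: "nat \<Rightarrow> (nat \<Rightarrow> nat \<Rightarrow> int) \<Rightarrow> (nat \<Rightarrow> int) \<Rightarrow> (nat \<Rightarrow> int) \<Rightarrow> int" where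
  "bilin m L a c = (\<Sum>i=1..m. \<Sum>j=1..m. a i * L i j * c j)"


subsection \<open>The quantum torus and its skew-field of fractions\<close>

definition laurent_in :: "'f::division_ring \<Rightarrow> 'f set" where
  "laurent_in h = {(\<Sum>m\<in>M. of_int (c m) * h powi m) | M c. finite M}"

definition central_indeterminate :: "'f::division_ring \<Rightarrow> bool" where
  "central_indeterminate h \<longleftrightarrow>
     h \<noteq> 0 \<and> (\<forall>y. h * y = y * h) \<and>
     (\<forall>M c. finite M \<longrightarrow> (\<Sum>m\<in>M. of_int (c m) * h powi m) = 0 \<longrightarrow> (\<forall>m\<in>M. c m = 0))"

definition torus_elements :: "nat \<Rightarrow> 'f::division_ring \<Rightarrow> ((nat \<Rightarrow> int) \<Rightarrow> 'f) \<Rightarrow> 'f set" where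
  "torus_elements m h X =
     {(\<Sum>a\<in>A. c a * X a) | A c.
        finite A \<and> A \<subseteq> lattice_vecs m \<and> (\<forall>a\<in>A. c a \<in> laurent_in h)}"

text \<open>
  The elements \<open>X a\<close> of the ambient skew-field form a \<open>\<int>[h, h\<^sup>-\<^sup>1]\<close>-basis of a copy of the quantum
  torus of \<open>L\<close>, where \<open>\<int>[h, h\<^sup>-\<^sup>1]\<close> is a genuine Laurent polynomial ring. That \<open>X 0 = 1\<close> follows.
\<close>
definition quantum_torus ::
  "nat \<Rightarrow> 'f::division_ring \<Rightarrow> (nat \<Rightarrow> nat \<Rightarrow> int) \<Rightarrow> ((nat \<Rightarrow> int) \<Rightarrow> 'f) \<Rightarrow> bool" where
  "quantum_torus m h L X \<longleftrightarrow>
     central_indeterminate h \<and>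
     (\<forall>a\<in>lattice_vecs m. \<forall>c\<in>lattice_vecs m.
        X a * X c = h powi (bilin m L a c) * X (\<lambda>i. a i + c i)) \<and>
     (\<forall>A c. finite A \<longrightarrow> A \<subseteq> lattice_vecs m \<longrightarrow> (\<forall>a\<in>A. c a \<in> laurent_in h) \<longrightarrow>
        (\<Sum>a\<in>A. c a * X a) = 0 \<longrightarrow> (\<forall>a\<in>A. c a = 0))"

text \<open>
  The type \<open>'f\<close> is the skew-field of fractions of the subset \<open>T\<close> (an Ore domain in the
  application, so that right fractions suffice).
\<close>
definition skew_field_of_fractions :: "'f::division_ring set \<Rightarrow> bool" where
  "skew_field_of_fractions T \<longleftrightarrow> (\<forall>y. \<exists>s\<in>T. \<exists>t\<in>T. t \<noteq> 0 \<and> y = s * inverse t)"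


subsection \<open>Quantum seeds\<close>

record 'f qseed =
  xvar :: "nat \<Rightarrow> 'f"
  lam :: "nat \<Rightarrow> nat \<Rightarrow> int"
  bmat :: "nat \<Rightarrow> nat \<Rightarrow> int"

definition skew_symmetric_form :: "nat \<Rightarrow> (nat \<Rightarrow> nat \<Rightarrow> int) \<Rightarrow> bool" where
  "skew_symmetric_form m L \<longleftrightarrow> (\<forall>i\<in>{1..m}. \<forall>j\<in>{1..m}. L i j = - L j i)"

definition skew_symmetrizable_by :: "nat \<Rightarrow> (nat \<Rightarrow> int) \<Rightarrow> (nat \<Rightarrow> nat \<Rightarrow> int) \<Rightarrow> bool" where
  "skew_symmetrizable_by n d B \<longleftrightarrow>
     (\<forall>j\<in>{1..n}. d j > 0) \<and> skew_symmetric_form n (\<lambda>i j. d i * B i j)"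

definition compatible :: "nat \<Rightarrow> (nat \<Rightarrow> int) \<Rightarrow> (nat \<Rightarrow> nat \<Rightarrow> int) \<Rightarrow> (nat \<Rightarrow> nat \<Rightarrow> int) \<Rightarrow> bool" where
  "compatible n d L B \<longleftrightarrow>
     (\<forall>i\<in>{1..2*n}. \<forall>j\<in>{1..n}.
        bilin (2*n) L (\<lambda>r. B r j) (unit_vec i) = (if i = j then d j else 0))"

definition quantum_seed ::
  "nat \<Rightarrow> 'f::division_ring \<Rightarrow> (nat \<Rightarrow> int) \<Rightarrow> ((nat \<Rightarrow> int) \<Rightarrow> 'f) \<Rightarrow> 'f qseed \<Rightarrow> bool" where
  "quantum_seed n h d X S \<longleftrightarrow>
     skew_symmetrizable_by n d (bmat S) \<and>
     skew_symmetric_form (2*n) (lam S) \<and>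
     compatible n d (lam S) (bmat S) \<and>
     quantum_torus (2*n) h (lam S) X \<and>
     skew_field_of_fractions (torus_elements (2*n) h X) \<and>
     (\<forall>i\<in>{1..2*n}. xvar S i = X (unit_vec i))"

definition principal_coefficients :: "nat \<Rightarrow> 'f qseed \<Rightarrow> bool" where
  "principal_coefficients n S \<longleftrightarrow>
     (\<forall>i\<in>{1..n}. \<forall>j\<in>{1..n}. bmat S (n + i) j = (if i = j then 1 else 0))"

definition acyclic_seed :: "nat \<Rightarrow> 'f qseed \<Rightarrow> bool" where
  "acyclic_seed n S \<longleftrightarrow> acyclic {(i, j). i \<in> {1..n} \<and> j \<in> {1..n} \<and> bmat S i j > 0}"


subsection \<open>Mutation\<close>

text \<open>
  The normalized monomial \<open>X\<^sup>a\<close> of an arbitrary seed. For the initial seed it agrees with \<open>X a\<close>.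
\<close>
definition seed_monomial ::
  "nat \<Rightarrow> 'f::division_ring \<Rightarrow> 'f qseed \<Rightarrow> (nat \<Rightarrow> int) \<Rightarrow> 'f" where
  "seed_monomial n h S a =
     h powi (\<Sum>k=1..2*n. \<Sum>l=1..<k. a k * a l * lam S k l) *
     prod_list (map (\<lambda>i. xvar S i powi a i) [1..<2*n+1])"

definition mutate_x :: "nat \<Rightarrow> 'f::division_ring \<Rightarrow> nat \<Rightarrow> 'f qseed \<Rightarrow> 'f" where
  "mutate_x n h k S =
     seed_monomial n h S (\<lambda>i. - unit_vec k i + max (bmat S i k) 0) +
     seed_monomial n h S (\<lambda>i. - unit_vec k i + max (- bmat S i k) 0)"

definition mutate_lam_row :: "nat \<Rightarrow> nat \<Rightarrow> 'f qseed \<Rightarrow> nat \<Rightarrow> int" where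
  "mutate_lam_row n k S j = - lam S k j + (\<Sum>t=1..2*n. max (bmat S t k) 0 * lam S t j)"

text \<open>The division by 2 in the exchange matrix rule is exact.\<close>
definition mutate :: "nat \<Rightarrow> 'f::division_ring \<Rightarrow> nat \<Rightarrow> 'f qseed \<Rightarrow> 'f qseed" where
  "mutate n h k S =
     \<lparr>xvar = (xvar S)(k := mutate_x n h k S),
      lam = (\<lambda>i j. if i = k \<and> j = k then 0
                   else if i = k then mutate_lam_row n k S j
                   else if j = k then - mutate_lam_row n k S i
                   else lam S i j),
      bmat = (\<lambda>i j. if i = k \<or> j = k then - bmat S i j
                    else bmat S i j +
                      (\<bar>bmat S i k\<bar> * bmat S k j + bmat S i k * \<bar>bmat S k j\<bar>) div 2)\<rparr>"

primrec mutate_upto :: "nat \<Rightarrow> 'f::division_ring \<Rightarrow> 'f qseed \<Rightarrow> nat \<Rightarrow> 'f qseed" where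
  "mutate_upto n h S 0 = S"
| "mutate_upto n h S (Suc i) = mutate n h (Suc i) (mutate_upto n h S i)"

definition projective_var :: "nat \<Rightarrow> 'f::division_ring \<Rightarrow> 'f qseed \<Rightarrow> nat \<Rightarrow> 'f" where
  "projective_var n h S i = xvar (mutate_upto n h S n) i"


subsection \<open>Subrings\<close>

inductive_set subring_gen :: "'f::division_ring set \<Rightarrow> 'f set" for G where
  gen: "y \<in> G \<Longrightarrow> y \<in> subring_gen G"
| one: "1 \<in> subring_gen G"
| diff: "y \<in> subring_gen G \<Longrightarrow> z \<in> subring_gen G \<Longrightarrow> y - z \<in> subring_gen G"
| mult: "y \<in> subring_gen G \<Longrightarrow> z \<in> subring_gen G \<Longrightarrow> y * z \<in> subring_gen G"

definition ZP :: "nat \<Rightarrow> 'f::division_ring \<Rightarrow> 'f qseed \<Rightarrow> 'f set" where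
  "ZP n h S =
     subring_gen ({h, inverse h} \<union> xvar S ` {n+1..2*n} \<union> (\<lambda>i. inverse (xvar S i)) ` {n+1..2*n})"

definition ZP_adjoin :: "nat \<Rightarrow> 'f::division_ring \<Rightarrow> 'f qseed \<Rightarrow> 'f set \<Rightarrow> 'f set" where
  "ZP_adjoin n h S Y = subring_gen (ZP n h S \<union> Y)"

definition qcommutator :: "nat \<Rightarrow> 'f::division_ring \<Rightarrow> 'f qseed \<Rightarrow> nat \<Rightarrow> nat \<Rightarrow> 'f" where
  "qcommutator n h S j l =
     projective_var n h S j ^ l * xvar S (j - 1) -
     (h ^ 2) powi (- int l * lam S j (j - 1)) * xvar S (j - 1) * projective_var n h S j ^ l"

end

theory Submission
  imports Defs
begin

text \<open>
  Since \<open>b\<^sub>i\<^sub>j \<ge> 0\<close> for \<open>i > j\<close>, every \<open>k\<close> is a sink of the exchange graph by the time the mutation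
  \<open>\<mu>\<^sub>k\<close> is performed: column \<open>k\<close> of the current exchange matrix is nonnegative and row \<open>k\<close> is
  nonpositive. The correction terms in the matrix rule then vanish, and compatibility makes those in
  the rule for \<open>\<Lambda>\<close> vanish too. Hence \<open>\<mu>\<^sub>k \<dots> \<mu>\<^sub>1\<close> just changes the sign of the entries of \<open>B\<close> and \<open>\<Lambda>\<close>
  with exactly one index in \<open>{1..k}\<close> (lemma \<open>sink_mutated_seed_seq\<close>). One of the two monomials
  in the exchange relation degenerates as well, so that \<open>x\<^sub>k\<^sup>(\<^sup>n\<^sup>) = M + x\<^sub>k\<^sup>-\<^sup>1\<close>, where \<open>M\<close> is a monomial
  in \<open>x\<^sub>i\<^sup>(\<^sup>n\<^sup>)\<close> for \<open>i < k\<close> and \<open>x\<^sub>i\<close> for \<open>i \<ge> k\<close> (lemma \<open>mutate_x_sink\<close>).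

  Let \<open>p = j - 1\<close>, \<open>x = x\<^sub>p\<close>, \<open>x' = x\<^sub>p\<^sup>(\<^sup>n\<^sup>)\<close>, \<open>y = x\<^sub>j\<^sup>(\<^sup>n\<^sup>)\<close> and \<open>Q = q\<^sup>-\<^sup>\<lambda>\<close> with \<open>\<lambda> = \<lambda>\<^sub>j\<^sub>,\<^sub>p\<close>. Up to a power of
  \<open>h\<close> the monomial in \<open>y\<close> is \<open>x'\<^sup>c G\<close>, where \<open>c = - b\<^sub>p\<^sub>j \<ge> 0\<close> and \<open>G\<close> involves neither \<open>x\<close> nor \<open>x'\<close>.
  Moving \<open>x\<close> to the left costs the factor \<open>Q\<close> both for \<open>x\<^sub>j\<^sup>-\<^sup>1\<close> and for \<open>G\<close>: apart from
  entry \<open>p\<close>, the exponents of \<open>G\<close> are those of \<open>x\<^sub>j\<^sup>-\<^sup>1\<close> plus column \<open>j\<close>, and the form vanishes on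
  column \<open>j\<close> and \<open>\<^bold>e\<^sub>p\<close>. So the summand \<open>x\<^sub>j\<^sup>-\<^sup>1\<close> of \<open>y\<close> disappears from the twisted commutator and, up to
  a power of \<open>h\<close>,
  \<open>y x - Q x y = Q (x'\<^sup>c x - x x'\<^sup>c) G\<close>.
  By the Leibniz rule the right-hand side is a sum of terms \<open>x'\<^sup>a (x' x - x x') x'\<^sup>b G\<close> with
  \<open>a + b = c - 1\<close>, and \<open>x' x - x x'\<close> is a scalar multiple of the monomial \<open>P\<close> of \<open>\<Sigma>\<^sup>(\<^sup>p\<^sup>-\<^sup>1\<^sup>)\<close>
  whose exponents form column \<open>p\<close> of the exchange matrix of that seed. The only negative exponent in \<open>G\<close> is the \<open>-1\<close> of \<open>x\<^sub>j\<close>. If \<open>c = 0\<close> there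
  are no terms at all; if \<open>c > 0\<close>, skew-symmetrizability gives \<open>b\<^sub>j\<^sub>p > 0\<close>, so \<open>P\<close> contains \<open>x\<^sub>j\<close> and
  \<open>P G\<close> has no negative exponents (lemma \<open>commutator_in_mixed_ring\<close>).

  For \<open>l \<ge> 2\<close> the twisted Leibniz rule \<open>qcommutator_Suc\<close> reduces the claim to the case \<open>l = 1\<close>, at the
  price of adjoining \<open>y\<close>.
\<close>

section \<open>Quasi-commutation up to powers of a central element\<close>

locale central_unit =
  fixes h :: "'f::division_ring"
  assumes nonzero: "h \<noteq> 0" and central: "h * y = y * h"
begin

lemma powi_central: "h powi a * y = y * h powi a"
proof -
  have inv: "inverse h * y = y * inverse h" for y
  proof -
    have "inverse h * y = inverse h * (y * h) * inverse h"
      using nonzero by (simp add: mult.assoc)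
    also have "\<dots> = inverse h * h * y * inverse h"
      by (simp only: central[of y, symmetric] mult.assoc)
    finally show ?thesis using nonzero by simp
  qed
  have pw: "g ^ m * y = y * g ^ m" if "\<And>y. g * y = y * g" for g :: 'f and m
    using that by (simp add: power_commuting_commutes)
  show ?thesis by (auto simp: power_int_def pw inv central)
qed

lemma powi_left_commute: "y * (h powi a * z) = h powi a * (y * z)"
  by (simp only: powi_central[of a y] mult.assoc[symmetric])

lemma powi_merge: "h powi a * (h powi b * z) = h powi (a + b) * z"
  using nonzero by (simp add: power_int_add mult.assoc)

definition quasi_commute :: "int \<Rightarrow> 'f \<Rightarrow> 'f \<Rightarrow> bool" where
  "quasi_commute a x y \<longleftrightarrow> x * y = h powi a * (y * x)"

lemma quasi_commute_refl: "quasi_commute 0 x x"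
  by (simp add: quasi_commute_def)

lemma quasi_commute_one: "quasi_commute 0 1 y"
  by (simp add: quasi_commute_def)

lemma quasi_commute_sym: "quasi_commute a x y \<Longrightarrow> quasi_commute (- a) y x"
  by (simp add: quasi_commute_def powi_merge)

lemma quasi_commute_scale: "quasi_commute a x y \<Longrightarrow> quasi_commute a (h powi r * x) y"
  by (simp add: quasi_commute_def mult.assoc powi_merge powi_left_commute[of y] add.commute)

lemma quasi_commute_add:
  "quasi_commute a x y \<Longrightarrow> quasi_commute a x' y \<Longrightarrow> quasi_commute a (x + x') y"
  by (simp add: quasi_commute_def algebra_simps)

lemma quasi_commute_mult:
  assumes "quasi_commute a x y" "quasi_commute b x' y"
  shows "quasi_commute (a + b) (x * x') y"
proof -
  have "x * x' * y = h powi b * (x * y * x')"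
    using assms(2) by (simp add: quasi_commute_def mult.assoc powi_left_commute[of x])
  also have "\<dots> = h powi b * (h powi a * (y * (x * x')))"
    using assms(1) by (simp add: quasi_commute_def mult.assoc)
  finally show ?thesis
    by (simp add: quasi_commute_def powi_merge add.commute)
qed

lemma quasi_commute_inverse:
  assumes "quasi_commute a x y" "x \<noteq> 0"
  shows "quasi_commute (- a) (inverse x) y"
proof -
  have "inverse x * (y * x) * inverse x = inverse x * (h powi (- a) * (x * y)) * inverse x"
    using assms(1) by (simp add: quasi_commute_def powi_merge)
  also have "\<dots> = h powi (- a) * (inverse x * x * y * inverse x)"
    by (simp add: powi_left_commute[of "inverse x"] mult.assoc)
  finally show ?thesis
    using assms(2) by (simp add: quasi_commute_def mult.assoc)
qed

lemma quasi_commute_powi: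
  assumes "quasi_commute a x y" "x \<noteq> 0 \<or> e \<ge> 0"
  shows "quasi_commute (a * e) (x powi e) y"
proof -
  have pow: "quasi_commute (a * int m) (x ^ m) y" if "quasi_commute a x y" for a x m
    by (induction m)
       (use that in \<open>auto simp: quasi_commute_one algebra_simps dest: quasi_commute_mult\<close>)
  show ?thesis
  proof (cases "e \<ge> 0")
    case True
    then show ?thesis using pow[OF assms(1), of "nat e"] by (simp add: power_int_def)
  next
    case False
    then show ?thesis
      using pow[OF quasi_commute_inverse[OF assms(1)], of "nat (- e)"] assms(2)
      by (simp add: power_int_def)
  qed
qed

lemma quasi_commute_prod_list:
  assumes "\<And>i. i \<in> set is \<Longrightarrow> quasi_commute (a i) (F i) y"
  shows "quasi_commute (\<Sum>i\<leftarrow>is. a i) (prod_list (map F is)) y"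
  using assms by (induction "is") (auto simp: quasi_commute_one intro: quasi_commute_mult)

subsection \<open>Ordered monomials in a quasi-commuting family\<close>

definition ordered_monomial :: "nat list \<Rightarrow> (nat \<Rightarrow> 'f) \<Rightarrow> (nat \<Rightarrow> int) \<Rightarrow> 'f" where
  "ordered_monomial is z e = prod_list (map (\<lambda>i. z i powi e i) is)"

lemma ordered_monomial_cong:
  "(\<And>i. i \<in> set is \<Longrightarrow> e i = f i \<and> (e i = 0 \<or> z i = w i)) \<Longrightarrow>
   ordered_monomial is z e = ordered_monomial is w f"
  unfolding ordered_monomial_def
  by (intro arg_cong[of _ _ prod_list] map_cong) (auto, metis power_int_0_right)

lemma ordered_monomial_single:
  assumes "distinct is" "p \<in> set is"
  shows "ordered_monomial is z (\<lambda>i. c * unit_vec p i) = z p powi c"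
proof -
  have zero: "ordered_monomial js z (\<lambda>i. c * unit_vec p i) = 1" if "p \<notin> set js" for js
    using that by (induction js) (auto simp: ordered_monomial_def unit_vec_def)
  have one: "ordered_monomial (k # js) z e = z k powi e k * ordered_monomial js z e" for k js e
    by (simp add: ordered_monomial_def)
  show ?thesis
    using assms
  proof (induction "is")
    case (Cons k js)
    then show ?case
      by (cases "k = p") (use zero[of js] in \<open>auto simp: one\<close>, auto simp: unit_vec_def)
  qed simp
qed

text \<open>
  Negative exponents are only admitted on nonzero variables. This proviso is carried along everywhere,
  since the mutated variables, which occur with nonnegative exponents only, then need not be shown to
  be nonzero.
\<close>
lemma quasi_commute_ordered_monomial:
  assumes "distinct is"
    and "\<And>i. i \<in> set is \<Longrightarrow> e i \<noteq> 0 \<Longrightarrow> quasi_commute (a i) (z i) y \<and> (z i \<noteq> 0 \<or> e i \<ge> 0)"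
  shows "quasi_commute (\<Sum>i\<in>set is. a i * e i) (ordered_monomial is z e) y"
proof -
  have "quasi_commute (a i * e i) (z i powi e i) y" if "i \<in> set is" for i
    using assms(2)[OF that] by (cases "e i = 0") (auto simp: quasi_commute_one quasi_commute_powi)
  then show ?thesis
    unfolding ordered_monomial_def using quasi_commute_prod_list[of "is"] assms(1)
    by (simp add: sum_list_distinct_conv_sum_set)
qed

text \<open>
  The power of \<open>h\<close> that arises from reordering is left implicit: membership in a ring that contains
  all powers of \<open>h\<close> does not depend on it.
\<close>
lemma ordered_monomial_mult:
  assumes "distinct is"
    and "\<And>i k. i \<in> set is \<Longrightarrow> k \<in> set is \<Longrightarrow> quasi_commute (a i k) (z i) (z k)"
    and "\<And>i. i \<in> set is \<Longrightarrow> z i \<noteq> 0 \<or> (e i \<ge> 0 \<and> f i \<ge> 0)"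
  shows "\<exists>r. ordered_monomial is z e * ordered_monomial is z f =
             h powi r * ordered_monomial is z (\<lambda>i. e i + f i)"
  using assms
proof (induction "is")
  case Nil
  then show ?case by (auto simp: ordered_monomial_def intro: exI[of _ 0])
next
  case (Cons k js)
  let ?M = "ordered_monomial js z" and ?y = "z k"
  \<comment> \<open>Only \<open>z k powi f k\<close> has to be moved, past the tail of the first factor.\<close>
  have split: "ordered_monomial (k # js) z g = ?y powi g k * ?M g" for g
    by (simp add: ordered_monomial_def)
  obtain r where r: "?M e * ?M f = h powi r * ?M (\<lambda>i. e i + f i)"
    using Cons by force
  let ?t = "\<Sum>i\<in>set js. a i k * e i"
  have "quasi_commute ?t (?M e) ?y"
    using Cons.prems by (intro quasi_commute_ordered_monomial) auto
  then have "quasi_commute (- (- ?t * f k)) (?M e) (?y powi f k)"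
    using Cons.prems(3)[of k]
    by (intro quasi_commute_sym[of "- ?t * f k"] quasi_commute_powi quasi_commute_sym) auto
  then obtain s where s: "?M e * ?y powi f k = h powi s * (?y powi f k * ?M e)"
    unfolding quasi_commute_def by blast
  have yy: "?y powi e k * ?y powi f k = ?y powi (e k + f k)"
  proof (cases "?y = 0")
    case True
    then have "e k \<ge> 0" "f k \<ge> 0" using Cons.prems(3)[of k] by auto
    then show ?thesis by (simp add: power_int_def nat_add_distrib power_add)
  qed (simp add: power_int_add)
  have "ordered_monomial (k # js) z e * ordered_monomial (k # js) z f =
        ?y powi e k * (?M e * ?y powi f k) * ?M f"
    by (simp add: split mult.assoc)
  also have "\<dots> = h powi s * ((?y powi e k * ?y powi f k) * (?M e * ?M f))"
    by (simp add: s mult.assoc powi_left_commute[of "?y powi e k"])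
  also have "\<dots> = h powi s * (h powi r * (?y powi (e k + f k) * ?M (\<lambda>i. e i + f i)))"
    by (simp add: r yy powi_left_commute[of "?y powi (e k + f k)"])
  finally show ?case
    by (auto simp: split powi_merge)
qed

end


section \<open>Subrings\<close>

lemma subring_gen_zero: "0 \<in> subring_gen G"
  using subring_gen.diff[OF subring_gen.one subring_gen.one] by simp

lemma subring_gen_add: "y \<in> subring_gen G \<Longrightarrow> z \<in> subring_gen G \<Longrightarrow> y + z \<in> subring_gen G"
  using subring_gen.diff[OF _ subring_gen.diff[OF subring_gen_zero], of y G z] by simp

lemma subring_gen_power: "y \<in> subring_gen G \<Longrightarrow> y ^ m \<in> subring_gen G"
  by (induction m) (auto intro: subring_gen.intros)

lemma subring_gen_powi: "y \<in> subring_gen G \<Longrightarrow> e \<ge> 0 \<Longrightarrow> y powi e \<in> subring_gen G"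
  by (simp add: power_int_def subring_gen_power)

lemma subring_gen_prod_list: "set ys \<subseteq> subring_gen G \<Longrightarrow> prod_list ys \<in> subring_gen G"
  by (induction ys) (auto intro: subring_gen.intros)

text \<open>
  The Leibniz rule writes the commutator of \<open>x' ^ m\<close> and \<open>x\<close> as a sum of products of powers of \<open>x'\<close>
  with one factor \<open>x' * x - x * x'\<close>. Only \<open>P * G\<close> is required to lie in the subring: \<open>G\<close> itself may
  contain an inverse that \<open>P\<close> clears, which is why \<open>P\<close> is moved to the right, next to \<open>G\<close>.
\<close>
lemma (in central_unit) commutator_power_mult_in_subring:
  assumes R: "R = subring_gen Y"
    and mem: "\<And>a. h powi a \<in> R" "x' \<in> R" "P * G \<in> R"
    and comm: "x' * x - x * x' = (h powi u - h powi v) * P"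
    and qc: "quasi_commute w P x'"
  shows "(x' ^ m * x - x * x' ^ m) * G \<in> R"
proof (induction m)
  case 0
  then show ?case by (simp add: R subring_gen_zero)
next
  case (Suc m)
  have "quasi_commute (- (- w * int m)) P (x' ^ m)"
    using quasi_commute_powi[OF quasi_commute_sym[OF qc], of "int m"]
    by (intro quasi_commute_sym) simp
  then have Px: "P * x' ^ m = h powi (w * int m) * (x' ^ m * P)"
    by (simp add: quasi_commute_def)
  have "(x' ^ Suc m * x - x * x' ^ Suc m) * G =
    x' * ((x' ^ m * x - x * x' ^ m) * G) + (x' * x - x * x') * (x' ^ m * G)"
    by (simp add: algebra_simps mult.assoc)
  also have "(x' * x - x * x') * (x' ^ m * G) = (h powi u - h powi v) * ((P * x' ^ m) * G)"
    by (simp add: comm mult.assoc)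
  also have "\<dots> = (h powi u - h powi v) * (h powi (w * int m) * (x' ^ m * (P * G)))"
    by (simp add: Px mult.assoc)
  finally show ?case
    using Suc.IH mem unfolding R
    by (auto intro!: subring_gen_add subring_gen.mult subring_gen.diff subring_gen_power)
qed

lemma h_powi_in_ZP_adjoin: "h powi a \<in> ZP_adjoin n h S Y"
proof -
  have "h \<in> ZP_adjoin n h S Y" "inverse h \<in> ZP_adjoin n h S Y"
    unfolding ZP_adjoin_def ZP_def by (blast intro: subring_gen.gen)+
  then show ?thesis
    unfolding ZP_adjoin_def power_int_def by (auto intro: subring_gen_power)
qed

lemma frozen_variable_in_ZP_adjoin: "i \<in> {n+1..2*n} \<Longrightarrow> xvar S i \<in> ZP_adjoin n h S Y"
  unfolding ZP_adjoin_def ZP_def by (blast intro: subring_gen.gen)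

lemma ZP_adjoin_mono: "Y \<subseteq> Y' \<Longrightarrow> ZP_adjoin n h S Y \<subseteq> ZP_adjoin n h S Y'"
proof
  fix y assume "y \<in> ZP_adjoin n h S Y" "Y \<subseteq> Y'"
  then have "y \<in> subring_gen (ZP n h S \<union> Y)" by (simp add: ZP_adjoin_def)
  then show "y \<in> ZP_adjoin n h S Y'"
    unfolding ZP_adjoin_def
    by induction (use \<open>Y \<subseteq> Y'\<close> in \<open>auto intro: subring_gen.intros\<close>)
qed

section \<open>Mutating an ordered seed at successive sinks\<close>

lemma bilin_unit_vec_right:
  assumes "l \<in> {1..m}"
  shows "bilin m L a (unit_vec l) = (\<Sum>i=1..m. a i * L i l)"
proof -
  have "(\<Sum>j=1..m. a i * L i j * unit_vec l j) = a i * L i l" for i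
    using assms by (simp add: unit_vec_def if_distrib[of "\<lambda>x. _ * x"] cong: if_cong)
  then show ?thesis by (simp add: bilin_def)
qed

lemma bilin_unit_vecs:
  assumes "i \<in> {1..m}" "l \<in> {1..m}"
  shows "bilin m L (unit_vec i) (unit_vec l) = L i l"
  unfolding bilin_unit_vec_right[OF assms(2)] using assms(1)
  by (simp add: unit_vec_def if_distrib[of "\<lambda>x. x * _"] cong: if_cong)

locale ordered_principal_seed =
  fixes n :: nat and h :: "'f::division_ring" and d :: "nat \<Rightarrow> int"
    and X :: "(nat \<Rightarrow> int) \<Rightarrow> 'f" and S :: "'f qseed"
  assumes seed: "quantum_seed n h d X S"
    and principal: "principal_coefficients n S"
    and ordered: "1 \<le> s \<Longrightarrow> s < r \<Longrightarrow> r \<le> n \<Longrightarrow> bmat S r s \<ge> 0"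
begin

sublocale central_unit h
proof
  have "central_indeterminate h"
    using seed unfolding quantum_seed_def quantum_torus_def by blast
  then show "h \<noteq> 0" "h * y = y * h" for y
    unfolding central_indeterminate_def by blast+
qed

abbreviation seed_seq :: "nat \<Rightarrow> 'f qseed" where
  "seed_seq \<equiv> mutate_upto n h S"

definition indices :: "nat list" where
  "indices = [1..<2*n+1]"

lemma set_indices [simp]: "set indices = {1..2*n}"
  by (auto simp: indices_def)

lemma distinct_indices [simp]: "distinct indices"
  by (simp add: indices_def)

abbreviation full_monomial :: "(nat \<Rightarrow> 'f) \<Rightarrow> (nat \<Rightarrow> int) \<Rightarrow> 'f" where
  "full_monomial \<equiv> ordered_monomial indices"

lemma seed_monomial_eq:
  "seed_monomial n h T a =
   h powi (\<Sum>k=1..2*n. \<Sum>l=1..<k. a k * a l * lam T k l) * full_monomial (xvar T) a"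
  by (simp add: seed_monomial_def ordered_monomial_def indices_def)

lemma full_monomial_single:
  "p \<in> {1..2*n} \<Longrightarrow> full_monomial z (\<lambda>i. c * unit_vec p i) = z p powi c"
  by (rule ordered_monomial_single) auto

lemma seed_parts:
  shows torus: "quantum_torus (2*n) h (lam S) X"
    and xvar_eq: "i \<in> {1..2*n} \<Longrightarrow> xvar S i = X (unit_vec i)"
    and compat: "compatible n d (lam S) (bmat S)"
    and skew: "skew_symmetric_form (2*n) (lam S)"
    and symmetrizable: "skew_symmetrizable_by n d (bmat S)"
  using seed unfolding quantum_seed_def by blast+

lemma torus_monomial_nonzero:
  assumes "a \<in> lattice_vecs (2*n)"
  shows "X a \<noteq> 0"
proof
  assume "X a = 0"
  have "(1::'f) = (\<Sum>m\<in>{0}. of_int ((\<lambda>_. 1) m) * h powi m)" by simp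
  then have one: "(1::'f) \<in> laurent_in h"
    unfolding laurent_in_def mem_Collect_eq
    by (intro exI[of _ "{0}"] exI[of _ "\<lambda>_. 1"]) simp
  have "\<forall>A c. finite A \<longrightarrow> A \<subseteq> lattice_vecs (2*n) \<longrightarrow> (\<forall>a\<in>A. c a \<in> laurent_in h) \<longrightarrow>
          (\<Sum>a\<in>A. c a * X a) = 0 \<longrightarrow> (\<forall>a\<in>A. c a = 0)"
    using torus by (simp add: quantum_torus_def)
  from this[rule_format, of "{a}" "\<lambda>_. 1"] show False
    using one assms \<open>X a = 0\<close> by simp
qed

lemma initial_variable_nonzero: "i \<in> {1..2*n} \<Longrightarrow> xvar S i \<noteq> 0"
  using xvar_eq torus_monomial_nonzero[of "unit_vec i"]
  by (auto simp: lattice_vecs_def unit_vec_def)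

lemma lam_skew: "i \<in> {1..2*n} \<Longrightarrow> l \<in> {1..2*n} \<Longrightarrow> lam S i l = - lam S l i"
  using skew unfolding skew_symmetric_form_def by blast

lemma initial_variables_quasi_commute:
  assumes "i \<in> {1..2*n}" "l \<in> {1..2*n}"
  shows "quasi_commute (2 * lam S i l) (xvar S i) (xvar S l)"
proof -
  have prod: "X (unit_vec r) * X (unit_vec t) =
      h powi (lam S r t) * X (\<lambda>i. unit_vec r i + unit_vec t i)"
    if "r \<in> {1..2*n}" "t \<in> {1..2*n}" for r t
  proof -
    have "unit_vec r \<in> lattice_vecs (2*n)" "unit_vec t \<in> lattice_vecs (2*n)"
      using that by (auto simp: lattice_vecs_def unit_vec_def)
    then show ?thesis
      using torus bilin_unit_vecs[OF that]
      by (simp add: quantum_torus_def)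
  qed
  have var: "xvar S i = X (unit_vec i)" "xvar S l = X (unit_vec l)"
    using xvar_eq assms by auto
  show ?thesis
    unfolding quasi_commute_def var prod[OF assms] prod[OF assms(2,1)] powi_merge
    using lam_skew[OF assms] by (simp add: add.commute)
qed

lemma compatibility:
  assumes "i \<in> {1..2*n}" "p \<in> {1..n}"
  shows "(\<Sum>t=1..2*n. bmat S t p * lam S t i) = (if i = p then d p else 0)"
  using compat assms bilin_unit_vec_right[OF assms(1), where L = "lam S" and a = "\<lambda>r. bmat S r p"]
  by (simp add: compatible_def)

lemma bmat_symmetrizable:
  assumes "r \<in> {1..n}" "t \<in> {1..n}"
  shows "d r > 0" "d r * bmat S r t = - (d t * bmat S t r)"
  using symmetrizable assms
  unfolding skew_symmetrizable_by_def skew_symmetric_form_def by blast+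

lemma bmat_diagonal: "p \<in> {1..n} \<Longrightarrow> bmat S p p = 0"
  using bmat_symmetrizable[of p p] by auto

lemma bmat_sgn:
  assumes "r \<in> {1..n}" "t \<in> {1..n}"
  shows "sgn (bmat S r t) = - sgn (bmat S t r)"
proof -
  have "sgn (d r * bmat S r t) = sgn (- (d t * bmat S t r))"
    by (simp only: bmat_symmetrizable(2)[OF assms])
  then show ?thesis
    using bmat_symmetrizable(1)[OF assms] bmat_symmetrizable(1)[OF assms(2,1)]
    by (simp add: sgn_mult)
qed

lemma bmat_above_diagonal:
  assumes "1 \<le> r" "r < t" "t \<le> n"
  shows "bmat S r t \<le> 0"
  using bmat_sgn[of r t] ordered[OF assms] assms by (simp add: sgn_if split: if_splits)

lemma bmat_lower: "n < i \<Longrightarrow> i \<le> 2*n \<Longrightarrow> p \<in> {1..n} \<Longrightarrow> bmat S i p \<ge> 0"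
  using principal[unfolded principal_coefficients_def, rule_format, of "i - n" p]
  by (cases "i - n = p") force+

text \<open>
  The sign of index \<open>i\<close> after the mutations at \<open>1, \<dots>, k\<close>.
\<close>
definition flip :: "nat \<Rightarrow> nat \<Rightarrow> int" where
  "flip k i = (if i \<le> k then -1 else 1)"

lemma flip_square: "flip k i * (flip k i * a) = a"
  by (simp add: flip_def)

text \<open>
  The invariant of the mutation sequence. The factor 2 is there because quasi-commutation is measured
  in powers of \<open>h\<close>, and \<open>q = h\<^sup>2\<close>.
\<close>
definition sink_mutated :: "nat \<Rightarrow> 'f qseed \<Rightarrow> bool" where
  "sink_mutated k T \<longleftrightarrow>
     (\<forall>i\<in>{1..2*n}. \<forall>l\<in>{1..2*n}. lam T i l = flip k i * flip k l * lam S i l) \<and>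
     (\<forall>i\<in>{1..2*n}. \<forall>l\<in>{1..n}. bmat T i l = flip k i * flip k l * bmat S i l) \<and>
     (\<forall>i\<in>{1..2*n}. \<forall>l\<in>{1..2*n}. quasi_commute (2 * lam T i l) (xvar T i) (xvar T l)) \<and>
     (\<forall>i>k. xvar T i = xvar S i)"

lemma sink_mutatedD:
  assumes "sink_mutated k T"
  shows "i \<in> {1..2*n} \<Longrightarrow> l \<in> {1..2*n} \<Longrightarrow> lam T i l = flip k i * flip k l * lam S i l"
    and "i \<in> {1..2*n} \<Longrightarrow> l \<in> {1..n} \<Longrightarrow> bmat T i l = flip k i * flip k l * bmat S i l"
    and "i \<in> {1..2*n} \<Longrightarrow> l \<in> {1..2*n} \<Longrightarrow> quasi_commute (2 * lam T i l) (xvar T i) (xvar T l)"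
    and "i > k \<Longrightarrow> xvar T i = xvar S i"
  using assms by (auto simp: sink_mutated_def)

text \<open>
  Compatibility survives because the signs of the summation index \<open>t\<close> cancel in every term, and the
  remaining two signs agree when \<open>i = p\<close>.
\<close>
lemma compatibility_sink_mutated:
  assumes T: "sink_mutated k T" and i: "i \<in> {1..2*n}" and p: "p \<in> {1..n}"
  shows "(\<Sum>t=1..2*n. bmat T t p * lam T t i) = (if i = p then d p else 0)"
proof -
  have "(\<Sum>t=1..2*n. bmat T t p * lam T t i) =
        (\<Sum>t=1..2*n. flip k p * (flip k i * (bmat S t p * lam S t i)))"
    using i p by (intro sum.cong) (auto simp: sink_mutatedD[OF T] flip_def)
  also have "\<dots> = flip k p * (flip k i * (\<Sum>t=1..2*n. bmat S t p * lam S t i))"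
    by (simp add: sum_distrib_left)
  finally show ?thesis
    using compatibility[OF i p] flip_square[of k p] by (cases "i = p") simp_all
qed

text \<open>
  Above the diagonal the entries of column \<open>Suc k\<close> of the initial matrix are nonpositive, but their
  rows have been flipped; below the diagonal they are nonnegative and unflipped. The frozen rows are
  nonnegative because the coefficients are principal.
\<close>
lemma sink_column:
  assumes T: "sink_mutated k T" and "Suc k \<le> n" "i \<in> {1..2*n}"
  shows "bmat T i (Suc k) \<ge> 0"
proof -
  have eq: "bmat T i (Suc k) = flip k i * bmat S i (Suc k)"
    using assms by (simp add: sink_mutatedD[OF T] flip_def)
  consider "i \<le> k" | "i = Suc k" | "Suc k < i" "i \<le> n" | "n < i" by linarith
  then show ?thesis
    unfolding eq using assms(2,3) bmat_above_diagonal[of i "Suc k"] bmat_diagonal[of "Suc k"]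
      ordered[of "Suc k" i] bmat_lower[of i "Suc k"]
    by cases (auto simp: flip_def)
qed

lemma sink_row:
  assumes T: "sink_mutated k T" and "Suc k \<le> n" "l \<in> {1..n}"
  shows "bmat T (Suc k) l \<le> 0"
proof -
  have eq: "bmat T (Suc k) l = flip k l * bmat S (Suc k) l"
    using assms by (simp add: sink_mutatedD[OF T] flip_def)
  consider "l \<le> k" | "l = Suc k" | "Suc k < l" by linarith
  then show ?thesis
    unfolding eq using assms(2,3) bmat_above_diagonal[of "Suc k" l] bmat_diagonal[of "Suc k"] ordered[of l "Suc k"]
    by cases (auto simp: flip_def)
qed

text \<open>
  As the column is nonnegative, the second exponent vector of the exchange relation is just minus a
  unit vector, and its normalizing power of \<open>h\<close> is trivial: the double sum runs over pairs of distinct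
  indices.
\<close>
lemma mutate_x_sink:
  assumes T: "sink_mutated k T" and k: "Suc k \<le> n"
  shows "\<exists>r. mutate_x n h (Suc k) T =
           h powi r * full_monomial (xvar T) (\<lambda>i. bmat T i (Suc k) - unit_vec (Suc k) i)
           + inverse (xvar S (Suc k))"
proof -
  let ?p = "Suc k"
  have pos: "full_monomial (xvar T) (\<lambda>i. - unit_vec ?p i + max (bmat T i ?p) 0) =
             full_monomial (xvar T) (\<lambda>i. bmat T i ?p - unit_vec ?p i)"
    using sink_column[OF T k] by (intro ordered_monomial_cong) auto
  have "full_monomial (xvar T) (\<lambda>i. - unit_vec ?p i + max (- bmat T i ?p) 0) =
        full_monomial (xvar T) (\<lambda>i. (- 1) * unit_vec ?p i)"
    using sink_column[OF T k] by (intro ordered_monomial_cong) auto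
  also have "\<dots> = inverse (xvar S ?p)"
    using k full_monomial_single[of ?p "xvar T" "- 1"] sink_mutatedD(4)[OF T, of ?p] by simp
  finally have neg: "full_monomial (xvar T) (\<lambda>i. - unit_vec ?p i + max (- bmat T i ?p) 0) =
    inverse (xvar S ?p)" .
  have "(\<Sum>i=1..2*n. \<Sum>l=1..<i. (- unit_vec ?p i + max (- bmat T i ?p) 0) *
           (- unit_vec ?p l + max (- bmat T l ?p) 0) * lam T i l) = 0"
  proof (intro sum.neutral ballI)
    fix i l assume "i \<in> {1..2*n}" "l \<in> {1..<i}"
    then show "(- unit_vec ?p i + max (- bmat T i ?p) 0) *
           (- unit_vec ?p l + max (- bmat T l ?p) 0) * lam T i l = 0"
      using sink_column[OF T k, of i] sink_column[OF T k, of l]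
      by (auto simp: unit_vec_def)
  qed
  then have "seed_monomial n h T (\<lambda>i. - unit_vec ?p i + max (- bmat T i ?p) 0) =
    inverse (xvar S ?p)"
    using neg by (simp add: seed_monomial_eq)
  then show ?thesis
    unfolding mutate_x_def using pos
    by (auto simp: seed_monomial_eq)
qed

text \<open>
  Compatibility evaluates the form on column \<open>Suc k\<close>: for \<open>l \<noteq> Suc k\<close> the exchange monomial commutes
  with \<open>xvar T l\<close> up to the same power of \<open>h\<close> as \<open>inverse (xvar T (Suc k))\<close> does, so that their sum,
  the new variable, quasi-commutes with \<open>xvar T l\<close>.
\<close>
lemma exchange_monomial_quasi_commute:
  assumes T: "sink_mutated k T" and k: "Suc k \<le> n" and l: "l \<in> {1..2*n}"
  shows "quasi_commute (2 * ((if l = Suc k then d (Suc k) else 0) - lam T (Suc k) l))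
           (full_monomial (xvar T) (\<lambda>i. bmat T i (Suc k) - unit_vec (Suc k) i)) (xvar T l)"
proof -
  let ?p = "Suc k"
  have "quasi_commute (\<Sum>i\<in>set indices. 2 * lam T i l * (bmat T i ?p - unit_vec ?p i))
          (full_monomial (xvar T) (\<lambda>i. bmat T i ?p - unit_vec ?p i)) (xvar T l)"
  proof (rule quasi_commute_ordered_monomial)
    fix i assume "i \<in> set indices"
    then have i: "i \<in> {1..2*n}" by auto
    have "xvar T i \<noteq> 0" if "i = ?p"
      using that i initial_variable_nonzero sink_mutatedD(4)[OF T, of i] by simp
    then show "quasi_commute (2 * lam T i l) (xvar T i) (xvar T l) \<and>
               (xvar T i \<noteq> 0 \<or> bmat T i ?p - unit_vec ?p i \<ge> 0)"
      using sink_mutatedD(3)[OF T i l] sink_column[OF T k i] by (auto simp: unit_vec_def)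
  qed simp
  also have "(\<Sum>i\<in>set indices. 2 * lam T i l * (bmat T i ?p - unit_vec ?p i)) =
             2 * (\<Sum>i=1..2*n. bmat T i ?p * lam T i l) - 2 * (\<Sum>i=1..2*n. unit_vec ?p i * lam T i l)"
    unfolding set_indices by (simp add: algebra_simps sum_subtractf sum_distrib_left)
  also have "(\<Sum>i=1..2*n. unit_vec ?p i * lam T i l) = lam T ?p l"
    using k by (simp add: unit_vec_def if_distrib[of "\<lambda>x. x * _"] cong: if_cong)
  finally show ?thesis
    using compatibility_sink_mutated[OF T l, of ?p] k by (simp add: algebra_simps)
qed

lemma sink_mutated_mutate:
  assumes T: "sink_mutated k T" and k: "Suc k \<le> n"
  shows "sink_mutated (Suc k) (mutate n h (Suc k) T)"
proof -
  let ?p = "Suc k" and ?U = "mutate n h (Suc k) T"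
  have flip: "flip ?p i = (if i = ?p then -1 else flip k i)" "flip k ?p = 1" for i
    by (auto simp: flip_def)
  \<comment> \<open>The correction term in the new row of \<open>\<Lambda>\<close> is the form on column \<open>?p\<close> and \<open>\<^bold>e\<^sub>l\<close>, hence zero.\<close>
  have row: "mutate_lam_row n ?p T l = - lam T ?p l" if "l \<in> {1..2*n}" "l \<noteq> ?p" for l
  proof -
    have "(\<Sum>t=1..2*n. max (bmat T t ?p) 0 * lam T t l) = (\<Sum>t=1..2*n. bmat T t ?p * lam T t l)"
      using sink_column[OF T k] by (intro sum.cong) auto
    then show ?thesis
      using compatibility_sink_mutated[OF T that(1), of ?p] that k
      by (simp add: mutate_lam_row_def)
  qed
  have lam: "lam ?U i l = flip ?p i * flip ?p l * lam S i l"
    if "i \<in> {1..2*n}" "l \<in> {1..2*n}" for i l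
    using that row[of i] row[of l] lam_skew[of i ?p] lam_skew[of i i] k
      sink_mutatedD(1)[OF T that] sink_mutatedD(1)[OF T _ that(1), of ?p]
      sink_mutatedD(1)[OF T _ that(2), of ?p]
    by (auto simp: mutate_def flip)
  have bmat: "bmat ?U i l = flip ?p i * flip ?p l * bmat S i l"
    if "i \<in> {1..2*n}" "l \<in> {1..n}" for i l
  proof -
    \<comment> \<open>The column is nonnegative and the row nonpositive, so the two products cancel.\<close>
    have "\<bar>bmat T i ?p\<bar> * bmat T ?p l + bmat T i ?p * \<bar>bmat T ?p l\<bar> = 0"
      using sink_column[OF T k that(1)] sink_row[OF T k that(2)] by simp
    then show ?thesis
      using sink_mutatedD(2)[OF T that] bmat_diagonal[of ?p] k
      by (auto simp: mutate_def flip)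
  qed
  have other: "xvar ?U i = xvar T i" if "i \<noteq> ?p" for i
    using that by (simp add: mutate_def)
  have new: "quasi_commute (2 * lam ?U ?p l) (xvar ?U ?p) (xvar ?U l)"
    if l: "l \<in> {1..2*n}" "l \<noteq> ?p" for l
  proof -
    obtain r where r: "xvar ?U ?p =
        h powi r * full_monomial (xvar T) (\<lambda>i. bmat T i ?p - unit_vec ?p i)
        + inverse (xvar S ?p)"
      using mutate_x_sink[OF T k] by (auto simp: mutate_def)
    have p: "?p \<in> {1..2*n}" using k by auto
    have "quasi_commute (- (2 * lam T ?p l)) (inverse (xvar T ?p)) (xvar T l)"
      using sink_mutatedD(3)[OF T p l(1)] sink_mutatedD(4)[OF T, of ?p]
        initial_variable_nonzero[OF p]
      by (intro quasi_commute_inverse) auto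
    then have "quasi_commute (- (2 * lam T ?p l)) (xvar ?U ?p) (xvar T l)"
      unfolding r using exchange_monomial_quasi_commute[OF T k l(1)] l(2)
        sink_mutatedD(4)[OF T, of ?p]
      by (intro quasi_commute_add quasi_commute_scale) auto
    then show ?thesis
      using l row[OF l] by (simp add: other mutate_def)
  qed
  have "quasi_commute (2 * lam ?U i l) (xvar ?U i) (xvar ?U l)"
    if il: "i \<in> {1..2*n}" "l \<in> {1..2*n}" for i l
  proof -
    consider "i = ?p" "l = ?p" | "i = ?p" "l \<noteq> ?p" | "i \<noteq> ?p" "l = ?p" | "i \<noteq> ?p" "l \<noteq> ?p"
      by blast
    then show ?thesis
    proof cases
      case 1
      then show ?thesis by (simp add: quasi_commute_refl mutate_def)
    next
      case 2
      then show ?thesis using new[OF il(2)] by simp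
    next
      case 3
      then show ?thesis
        using quasi_commute_sym[OF new[OF il(1)]] by (simp add: mutate_def)
    next
      case 4
      then show ?thesis using sink_mutatedD(3)[OF T il] by (simp add: mutate_def)
    qed
  qed
  then show ?thesis
    using lam bmat other sink_mutatedD(4)[OF T] by (simp add: sink_mutated_def)
qed

lemma sink_mutated_seed_seq: "k \<le> n \<Longrightarrow> sink_mutated k (seed_seq k)"
proof (induction k)
  case 0
  then show ?case
    using initial_variables_quasi_commute by (auto simp: sink_mutated_def flip_def)
next
  case (Suc k)
  then show ?case using sink_mutated_mutate by simp
qed

text \<open>
  Variable \<open>i\<close> is replaced at step \<open>i\<close> only.
\<close>
lemma seed_seq_projective_var:
  assumes "i \<le> m" "m \<le> n"
  shows "xvar (seed_seq m) i = projective_var n h S i"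
  using assms(2,1) unfolding projective_var_def
proof (induction m rule: inc_induct)
  case (step m)
  then show ?case by (simp add: mutate_def)
qed simp

section \<open>The commutator\<close>

text \<open>
  For \<open>p = j - 1\<close> this is the ring in which the twisted commutator with \<open>l = 1\<close> is to be found. Its
  generators over \<open>ZP\<close> are the mutable variables of \<open>\<Sigma>\<^sup>(\<^sup>p\<^sup>)\<close>.
\<close>
definition mixed_ring :: "nat \<Rightarrow> 'f set" where
  "mixed_ring p = ZP_adjoin n h S (projective_var n h S ` {1..p} \<union> xvar S ` {Suc p..n})"

lemma mixed_ring_mult: "u \<in> mixed_ring p \<Longrightarrow> v \<in> mixed_ring p \<Longrightarrow> u * v \<in> mixed_ring p"
  unfolding mixed_ring_def ZP_adjoin_def by (rule subring_gen.mult)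

lemma h_powi_in_mixed_ring: "h powi a \<in> mixed_ring p"
  unfolding mixed_ring_def by (rule h_powi_in_ZP_adjoin)

lemma seed_seq_variable_in_mixed_ring:
  assumes "p \<le> n" "i \<in> {1..2*n}"
  shows "xvar (seed_seq p) i \<in> mixed_ring p"
proof -
  have later: "xvar (seed_seq p) i = xvar S i" if "p < i"
    using sink_mutatedD(4)[OF sink_mutated_seed_seq[OF assms(1)] that] .
  consider "i \<le> p" | "p < i" "i \<le> n" | "n < i" by linarith
  then show ?thesis
  proof cases
    case 1
    then have "xvar (seed_seq p) i \<in> projective_var n h S ` {1..p}"
      using seed_seq_projective_var[of i p] assms by auto
    then show ?thesis unfolding mixed_ring_def ZP_adjoin_def by (auto intro: subring_gen.gen)
  next
    case 2
    then have "xvar (seed_seq p) i \<in> xvar S ` {Suc p..n}"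
      using later by auto
    then show ?thesis unfolding mixed_ring_def ZP_adjoin_def by (auto intro: subring_gen.gen)
  next
    case 3
    then show ?thesis
      using later assms frozen_variable_in_ZP_adjoin[of i n S] by (auto simp: mixed_ring_def)
  qed
qed

lemma monomial_in_mixed_ring:
  assumes "p \<le> n" "\<And>i. i \<in> {1..2*n} \<Longrightarrow> e i \<ge> 0"
  shows "full_monomial (xvar (seed_seq p)) e \<in> mixed_ring p"
proof -
  have "xvar (seed_seq p) i powi e i \<in> mixed_ring p" if "i \<in> {1..2*n}" for i
    using seed_seq_variable_in_mixed_ring[OF assms(1) that] assms(2)[OF that]
    unfolding mixed_ring_def ZP_adjoin_def by (rule subring_gen_powi)
  then show ?thesis
    unfolding ordered_monomial_def mixed_ring_def ZP_adjoin_def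
    by (intro subring_gen_prod_list) auto
qed

text \<open>
  The summand \<open>inverse x\<close> of the new variable commutes with \<open>x\<close>. The other summand \<open>N\<close> quasi-commutes
  with \<open>x\<close>, so both \<open>N * x\<close> and \<open>x * N\<close> are multiples of the monomial in which the factor
  \<open>inverse x\<close> of \<open>N\<close> has been cancelled.
\<close>
lemma sink_exchange_commutator:
  assumes T: "sink_mutated k T" and k: "Suc k \<le> n"
  shows "\<exists>u v. mutate_x n h (Suc k) T * xvar S (Suc k) - xvar S (Suc k) * mutate_x n h (Suc k) T =
           (h powi u - h powi v) * full_monomial (xvar T) (\<lambda>i. bmat T i (Suc k))"
proof -
  let ?p = "Suc k" and ?b = "\<lambda>i. bmat T i (Suc k)" and ?x = "xvar S (Suc k)"
  let ?N = "full_monomial (xvar T) (\<lambda>i. ?b i - unit_vec ?p i)" and ?P = "full_monomial (xvar T) ?b"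
  have p: "?p \<in> {1..2*n}" using k by auto
  have x: "xvar T ?p = ?x" using sink_mutatedD(4)[OF T] by simp
  have x0: "?x \<noteq> 0" by (rule initial_variable_nonzero[OF p])
  obtain s where s: "mutate_x n h ?p T = h powi s * ?N + inverse ?x"
    using mutate_x_sink[OF T k] by auto
  have "\<exists>r. ?N * full_monomial (xvar T) (\<lambda>i. 1 * unit_vec ?p i) =
        h powi r * full_monomial (xvar T) (\<lambda>i. ?b i - unit_vec ?p i + 1 * unit_vec ?p i)"
  proof (rule ordered_monomial_mult)
    fix i assume "i \<in> set indices"
    then show "xvar T i \<noteq> 0 \<or> ?b i - unit_vec ?p i \<ge> 0 \<and> 1 * unit_vec ?p i \<ge> 0"
      using sink_column[OF T k, of i] x0 x by (auto simp: unit_vec_def)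
  qed (use sink_mutatedD(3)[OF T] in auto)
  then obtain t where t: "?N * ?x = h powi t * ?P"
    using full_monomial_single[OF p, of "xvar T" 1] x by auto
  obtain w where "quasi_commute w ?N ?x"
    using exchange_monomial_quasi_commute[OF T k p] x by auto
  then have "?x * ?N = h powi (- w) * (?N * ?x)"
    using quasi_commute_sym by (auto simp: quasi_commute_def powi_merge)
  then have xN: "?x * ?N = h powi (t - w) * ?P"
    by (simp add: t powi_merge add.commute)
  have "mutate_x n h ?p T * ?x - ?x * mutate_x n h ?p T =
        h powi s * (?N * ?x) - h powi s * (?x * ?N)"
    using x0 by (simp add: s distrib_left distrib_right mult.assoc powi_left_commute[of ?x])
  also have "\<dots> = (h powi (s + t) - h powi (s + (t - w))) * ?P"
    by (simp add: t xN powi_merge left_diff_distrib)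
  finally show ?thesis by blast
qed

text \<open>
  Here \<open>A\<close> and \<open>B\<close> are the seeds before and after the mutation at \<open>j - 1\<close>; \<open>x\<close> and \<open>x'\<close> are their
  variables at that index. Monomials without the variable at \<open>j - 1\<close> can be read in either seed: \<open>A\<close>
  serves to commute them with \<open>x\<close>, and \<open>B\<close> to commute them with \<open>x'\<close>.
\<close>
lemma commutator_in_mixed_ring:
  assumes j: "Suc (Suc k) \<le> n"
  shows "qcommutator n h S (Suc (Suc k)) 1 \<in> mixed_ring (Suc k)"
proof -
  let ?p = "Suc k" and ?j = "Suc (Suc k)"
  define A where "A = seed_seq k"
  define B where "B = seed_seq ?p"
  have B_mutate: "B = mutate n h ?p A" by (simp add: A_def B_def)
  let ?x = "xvar S ?p" and ?y = "projective_var n h S ?j" and ?x' = "xvar B ?p"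
  have A: "sink_mutated k A" and B: "sink_mutated ?p B"
    unfolding A_def B_def using j by (auto intro: sink_mutated_seed_seq simp del: mutate_upto.simps)
  have p: "?p \<in> {1..2*n}" "?p \<in> {1..n}" "?p \<le> n" and jj: "?j \<in> {1..2*n}" "?j \<in> {1..n}"
    using j by auto
  have AB: "xvar B i = xvar A i" if "i \<noteq> ?p" for i
    using that by (simp add: B_mutate mutate_def)
  have xA: "xvar A ?p = ?x" and xB: "xvar B ?j = xvar S ?j"
    using sink_mutatedD(4)[OF A, of ?p] sink_mutatedD(4)[OF B, of ?j] by auto

  define e where "e = (\<lambda>i. bmat B i ?j - unit_vec ?j i)"
  define c where "c = e ?p"
  define e0 where "e0 = (\<lambda>i. if i = ?p then 0 else e i)"
  define G where "G = full_monomial (xvar B) e0"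
  define Q where "Q = h powi (- 2 * lam S ?j ?p)"
  have e_nonneg: "e i \<ge> 0" if "i \<in> {1..2*n}" "i \<noteq> ?j" for i
    using sink_column[OF B j that(1)] that(2) by (simp add: e_def unit_vec_def)
  have c_nonneg: "c \<ge> 0" using e_nonneg[OF p(1)] by (simp add: c_def)
  have e0_valid: "xvar B i \<noteq> 0 \<or> e0 i \<ge> 0" if "i \<in> {1..2*n}" for i
    using e_nonneg[OF that] initial_variable_nonzero[OF jj(1)] xB
    by (cases "i = ?j") (auto simp: e0_def)

  obtain r where r: "?y = h powi r * full_monomial (xvar B) e + inverse (xvar S ?j)"
  proof -
    have "?y = xvar (seed_seq ?j) ?j" using seed_seq_projective_var[of ?j ?j] j by simp
    also have "\<dots> = mutate_x n h ?j B" by (simp add: mutate_def B_def)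
    finally show ?thesis using mutate_x_sink[OF B j] that by (auto simp: e_def)
  qed

  \<comment> \<open>Up to a power of \<open>h\<close>, the factor \<open>x'\<^sup>c\<close> is split off to the left of the exchange monomial.\<close>
  obtain r' where "?x' powi c * G = h powi r' * full_monomial (xvar B) e"
  proof -
    have "\<exists>r. full_monomial (xvar B) (\<lambda>i. c * unit_vec ?p i) * full_monomial (xvar B) e0 =
          h powi r * full_monomial (xvar B) (\<lambda>i. c * unit_vec ?p i + e0 i)"
    proof (rule ordered_monomial_mult)
      fix i assume "i \<in> set indices"
      then show "xvar B i \<noteq> 0 \<or> c * unit_vec ?p i \<ge> 0 \<and> e0 i \<ge> 0"
        using e0_valid[of i] c_nonneg by (auto simp: unit_vec_def)
    qed (use sink_mutatedD(3)[OF B] in auto)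
    moreover have "(\<lambda>i. c * unit_vec ?p i + e0 i) = e"
      by (auto simp: unit_vec_def e0_def c_def)
    ultimately show ?thesis
      using that full_monomial_single[OF p(1), of "xvar B" c] by (auto simp: G_def)
  qed
  then have "full_monomial (xvar B) e = h powi (- r') * (?x' powi c * G)"
    by (simp add: powi_merge)
  then have y: "?y = h powi (r - r') * (?x' ^ nat c * G) + inverse (xvar S ?j)"
    using c_nonneg power_int_of_nat[of ?x' "nat c"] by (simp add: r powi_merge)

  \<comment> \<open>\<open>Q\<close> is computed from compatibility in the initial seed: leaving out the entry \<open>?p\<close> of the exponent
    vector is harmless as \<open>lam S ?p ?p = 0\<close>, and the signs in \<open>A\<close> and \<open>B\<close> agree at all other indices.\<close>
  have Gx: "G * ?x = Q * (?x * G)"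
  proof -
    have "G = full_monomial (xvar A) e0"
      unfolding G_def using AB by (intro ordered_monomial_cong) (auto simp: e0_def)
    moreover have "quasi_commute (\<Sum>i\<in>set indices. 2 * lam A i ?p * e0 i)
        (full_monomial (xvar A) e0) (xvar A ?p)"
    proof (rule quasi_commute_ordered_monomial)
      fix i assume i: "i \<in> set indices" "e0 i \<noteq> 0"
      then have "i \<noteq> ?p" by (auto simp: e0_def)
      then show "quasi_commute (2 * lam A i ?p) (xvar A i) (xvar A ?p) \<and>
                 (xvar A i \<noteq> 0 \<or> e0 i \<ge> 0)"
        using i sink_mutatedD(3)[OF A _ p(1), of i] e0_valid[of i] AB[of i]
        by auto
    qed simp
    moreover have "(\<Sum>i\<in>set indices. 2 * lam A i ?p * e0 i) = - 2 * lam S ?j ?p"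
    proof -
      have "2 * lam A i ?p * e0 i = 2 * (bmat S i ?j * lam S i ?p) - 2 * (unit_vec ?j i * lam S i ?p)"
        if "i \<in> {1..2*n}" for i
        using that sink_mutatedD(1)[OF A that p(1)] sink_mutatedD(2)[OF B that jj(2)]
          lam_skew[OF p(1) p(1)]
        by (auto simp: e0_def e_def flip_def unit_vec_def algebra_simps)
      then have "(\<Sum>i\<in>set indices. 2 * lam A i ?p * e0 i) =
         (\<Sum>i=1..2*n. 2 * (bmat S i ?j * lam S i ?p) - 2 * (unit_vec ?j i * lam S i ?p))"
        unfolding set_indices by (intro sum.cong) auto
      also have "\<dots> = 2 * (\<Sum>i=1..2*n. bmat S i ?j * lam S i ?p) -
          2 * (\<Sum>i=1..2*n. unit_vec ?j i * lam S i ?p)"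
        by (simp add: sum_subtractf sum_distrib_left)
      also have "(\<Sum>i=1..2*n. unit_vec ?j i * lam S i ?p) = lam S ?j ?p"
        using jj by (simp add: unit_vec_def if_distrib[of "\<lambda>x. x * _"] cong: if_cong)
      finally show ?thesis using compatibility[OF p(1) jj(2)] by simp
    qed
    ultimately show ?thesis by (simp add: quasi_commute_def Q_def xA)
  qed
  have invx: "inverse (xvar S ?j) * ?x = Q * (?x * inverse (xvar S ?j))"
    using quasi_commute_inverse[OF initial_variables_quasi_commute[OF jj(1) p(1)]
        initial_variable_nonzero[OF jj(1)]]
    by (simp add: quasi_commute_def Q_def)

  \<comment> \<open>\<open>inverse (xvar S ?j)\<close> commutes with \<open>x\<close> up to the same \<open>Q\<close> as \<open>G\<close>, so its contribution cancels.\<close>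
  have "qcommutator n h S ?j 1 = ?y * ?x - Q * ?x * ?y"
    by (simp add: qcommutator_def Q_def power_int_power)
  also have "\<dots> = h powi (r - r') * (Q * ((?x' ^ nat c * ?x - ?x * ?x' ^ nat c) * G))"
  proof -
    have 1: "h powi (r - r') * (?x' ^ nat c * G) * ?x =
             h powi (r - r') * (Q * (?x' ^ nat c * ?x * G))"
      by (simp add: mult.assoc Gx) (simp add: Q_def powi_left_commute[of "?x' ^ nat c"])
    have 2: "Q * ?x * (h powi (r - r') * (?x' ^ nat c * G)) =
             h powi (r - r') * (Q * (?x * ?x' ^ nat c * G))"
      by (simp add: mult.assoc powi_left_commute[of ?x] powi_left_commute[of Q])
    show ?thesis
      unfolding y distrib_left distrib_right 1 2
      by (simp add: invx mult.assoc left_diff_distrib right_diff_distrib)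
  qed
  finally have comm: "qcommutator n h S ?j 1 =
    h powi (r - r') * (Q * ((?x' ^ nat c * ?x - ?x * ?x' ^ nat c) * G))" .

  define b where "b = (\<lambda>i. bmat A i ?p)"
  define P where "P = full_monomial (xvar B) b"
  have b_nonneg: "b i \<ge> 0" if "i \<in> {1..2*n}" for i
    using sink_column[OF A p(3) that] by (simp add: b_def)
  have bp: "b ?p = 0"
    using sink_mutatedD(2)[OF A p(1,2)] bmat_diagonal[OF p(2)] by (simp add: b_def)
  have "full_monomial (xvar A) b = P"
    unfolding P_def using AB bp by (intro ordered_monomial_cong) (metis (full_types))
  then obtain u v where D1: "?x' * ?x - ?x * ?x' = (h powi u - h powi v) * P"
    using sink_exchange_commutator[OF A p(3)] by (auto simp: B_mutate mutate_def b_def)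
  have Px': "quasi_commute (\<Sum>i\<in>set indices. 2 * lam B i ?p * b i) P ?x'"
    unfolding P_def using sink_mutatedD(3)[OF B _ p(1)] b_nonneg
    by (intro quasi_commute_ordered_monomial) auto

  have "(?x' ^ nat c * ?x - ?x * ?x' ^ nat c) * G \<in> mixed_ring ?p"
  proof (cases "c = 0")
    case True
    then show ?thesis by (simp add: mixed_ring_def ZP_adjoin_def subring_gen_zero)
  next
    case False
    have "c = - bmat S ?p ?j"
      using sink_mutatedD(2)[OF B p(1) jj(2)] by (simp add: c_def e_def flip_def unit_vec_def)
    then have "bmat S ?j ?p > 0"
      using False c_nonneg bmat_sgn[OF p(2) jj(2)] by (simp add: sgn_if split: if_splits)
    \<comment> \<open>This exponent of \<open>P\<close> compensates the exponent \<open>-1\<close> of \<open>xvar S ?j\<close> in \<open>G\<close>.\<close>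
    then have bj: "b ?j \<ge> 1"
      using sink_mutatedD(2)[OF A jj(1) p(2)] by (simp add: b_def flip_def)
    have "\<exists>r. P * G = h powi r * full_monomial (xvar B) (\<lambda>i. b i + e0 i)"
      unfolding P_def G_def
    proof (rule ordered_monomial_mult)
      fix i assume "i \<in> set indices"
      then show "xvar B i \<noteq> 0 \<or> b i \<ge> 0 \<and> e0 i \<ge> 0"
        using e0_valid[of i] b_nonneg[of i] by auto
    qed (use sink_mutatedD(3)[OF B] in auto)
    moreover have "full_monomial (xvar B) (\<lambda>i. b i + e0 i) \<in> mixed_ring ?p"
      unfolding B_def
    proof (rule monomial_in_mixed_ring[OF p(3)])
      fix i assume i: "i \<in> {1..2*n}"
      show "b i + e0 i \<ge> 0"
      proof (cases "i = ?j")
        case True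
        then show ?thesis
          using bj sink_column[OF B j i] by (simp add: e0_def e_def unit_vec_def)
      next
        case False
        then show ?thesis using b_nonneg[OF i] e_nonneg[OF i] by (simp add: e0_def)
      qed
    qed
    ultimately have PG: "P * G \<in> mixed_ring ?p"
      using h_powi_in_mixed_ring mixed_ring_mult by auto
    have x': "?x' \<in> mixed_ring ?p"
      unfolding B_def by (rule seed_seq_variable_in_mixed_ring[OF p(3,1)])
    show ?thesis
      using commutator_power_mult_in_subring[OF _ h_powi_in_mixed_ring x' PG D1 Px']
      by (simp add: mixed_ring_def ZP_adjoin_def)
  qed
  then show ?thesis
    unfolding comm Q_def using h_powi_in_mixed_ring mixed_ring_mult by blast
qed

end

text \<open>
  The twisted Leibniz rule \<open>y\<^sup>l\<^sup>+\<^sup>1 x - Q\<^sup>l\<^sup>+\<^sup>1 x y\<^sup>l\<^sup>+\<^sup>1 = y (y\<^sup>l x - Q\<^sup>l x y\<^sup>l) + Q\<^sup>l (y x - Q x y) y\<^sup>l\<close> for a central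
  \<open>Q\<close>.
\<close>
lemma qcommutator_Suc:
  assumes "central_unit h"
  shows "qcommutator n h S j (Suc l) =
     projective_var n h S j * qcommutator n h S j l +
     h powi (- 2 * int l * lam S j (j - 1)) * (qcommutator n h S j 1 * projective_var n h S j ^ l)"
proof -
  interpret central_unit h by fact
  let ?y = "projective_var n h S j" and ?x = "xvar S (j - 1)"
  define Q where "Q m = h powi (- 2 * int m * lam S j (j - 1))" for m
  have comm: "qcommutator n h S j m = ?y ^ m * ?x - Q m * (?x * ?y ^ m)" for m
    by (simp add: qcommutator_def power_int_power mult.assoc Q_def)
  have pull: "?y * (Q l * z) = Q l * (?y * z)" for z
    unfolding Q_def by (rule powi_left_commute)
  have merge: "Q l * (Q 1 * z) = Q (Suc l) * z" for z
    unfolding Q_def powi_merge by (simp add: algebra_simps)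
  show ?thesis
    unfolding comm Q_def[symmetric]
    by (simp add: right_diff_distrib left_diff_distrib mult.assoc pull merge[unfolded One_nat_def])
qed

theorem lemma4p2:
  fixes n :: nat and h :: "'f::division_ring" and d :: "nat \<Rightarrow> int"
    and X :: "(nat \<Rightarrow> int) \<Rightarrow> 'f" and S :: "'f qseed" and j :: nat
  assumes "quantum_seed n h d X S"
    and "principal_coefficients n S"
    and "acyclic_seed n S"
    and "\<And>r s. 1 \<le> s \<Longrightarrow> s < r \<Longrightarrow> r \<le> n \<Longrightarrow> bmat S r s \<ge> 0"
    and "j \<in> {2..n}"
  shows "qcommutator n h S j 1
           \<in> ZP_adjoin n h S (projective_var n h S ` {1..j-1} \<union> xvar S ` {j..n})
       \<and> (\<forall>l\<ge>2. qcommutator n h S j l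
           \<in> ZP_adjoin n h S (projective_var n h S ` {1..j} \<union> xvar S ` {j..n}))"
proof -
  interpret ordered_principal_seed n h d X S
    using assms by unfold_locales auto
  let ?Y = "projective_var n h S ` {1..j} \<union> xvar S ` {j..n}"
  obtain k where k: "j = Suc (Suc k)"
    using assms(5) by (metis Suc_le_D atLeastAtMost_iff numeral_2_eq_2 Suc_le_mono)
  have one: "qcommutator n h S j 1
      \<in> ZP_adjoin n h S (projective_var n h S ` {1..j-1} \<union> xvar S ` {j..n})"
    using commutator_in_mixed_ring[of k] assms(5) k by (simp add: mixed_ring_def)
  have one': "qcommutator n h S j 1 \<in> subring_gen (ZP n h S \<union> ?Y)"
    using one ZP_adjoin_mono[of "projective_var n h S ` {1..j-1} \<union> xvar S ` {j..n}" ?Y n h S]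
    unfolding ZP_adjoin_def by fastforce
  have y: "projective_var n h S j \<in> subring_gen (ZP n h S \<union> ?Y)"
    using k by (auto intro: subring_gen.gen)
  have "qcommutator n h S j l \<in> subring_gen (ZP n h S \<union> ?Y)" for l
  proof (induction l)
    case 0
    then show ?case by (simp add: qcommutator_def subring_gen_zero)
  next
    case (Suc l)
    then show ?case
      unfolding qcommutator_Suc[OF central_unit_axioms]
      using one' y h_powi_in_ZP_adjoin[of h _ n S ?Y] unfolding ZP_adjoin_def
      by (intro subring_gen_add subring_gen.mult subring_gen_power) auto
  qed
  then show ?thesis using one by (simp add: ZP_adjoin_def)
qed

end
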